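(* Let $t$ be a closed proof-term of the $\odot$-calculus which is irreducible (has no one-step reduct) and such that $\vdash t : A$ (empty context). Then: if $A=\top$, then $t = *$; $A$ is not $\bot$; if $A = B\Rightarrow C$, then $t$ has the form $\lambda x\,u$; if $A = B\wedge C$, then $t$ has the form $\langle u,v\rangle$; if $A = B\vee C$, then $t$ has the form $\mathrm{inl}(u)$, $\mathrm{inr}(u)$, or $u\parallel v$; if $A = B\odot C$, then $t$ has the form $u+v$.
   Context: The $\odot$-calculus. Propositions: $A ::= \top \mid \bot \mid A \Rightarrow A \mid A \wedge A \mid A \vee A \mid A \odot A$. Proof-terms: $t ::= x \mid t \parallel u \mid * \mid \delta_\bot(t) \mid \lambda x\, t \mid t\,u \mid \langle t,u\rangle \mid \delta_\wedge(t,[x,y]u) \mid \mathrm{inl}(t) \mid \mathrm{inr}(t) \mid \delta_\vee(t,[x]u,[y]v) \mid t+u \mid \delta_\odot(t,[x]u,[y]v) \mid \delta_\odot^\parallel(t,[x]u,[y]v)$, where $\lambda x$ binds $x$, $[x,y]$ binds $x,y$, and $[x]$, $[y]$ bind $x$, $y$; a term is closed if it has no free variables; $(u/x)t$ is capture-avoiding substitution. Typing rules: $\Gamma\vdash x:A$ if $x:A\in\Gamma$; from $\Gamma\vdash t:A$ and $\Gamma\vdash u:A$ infer $\Gamma\vdash t\parallel u:A$; $\Gamma\vdash *:\top$; from $\Gamma\vdash t:\bot$ infer $\Gamma\vdash\delta_\bot(t):C$; from $\Gamma,x:A\vdash t:B$ infer $\Gamma\vdash\lambda x\,t:A\Rightarrow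 B$; from $\Gamma\vdash t:A\Rightarrow B$ and $\Gamma\vdash u:A$ infer $\Gamma\vdash t\,u:B$; from $\Gamma\vdash t:A$, $\Gamma\vdash u:B$ infer $\Gamma\vdash\langle t,u\rangle:A\wedge B$; from $\Gamma\vdash t:A\wedge B$ and $\Gamma,x:A,y:B\vdash u:C$ infer $\Gamma\vdash\delta_\wedge(t,[x,y]u):C$; from $\Gamma\vdash t:A$ infer $\Gamma\vdash\mathrm{inl}(t):A\vee B$; from $\Gamma\vdash t:B$ infer $\Gamma\vdash\mathrm{inr}(t):A\vee B$; from $\Gamma\vdash t:A\vee B$, $\Gamma,x:A\vdash u:C$, $\Gamma,y:B\vdash v:C$ infer $\Gamma\vdash\delta_\vee(t,[x]u,[y]v):C$; from $\Gamma\vdash t:A$, $\Gamma\vdash u:B$ infer $\Gamma\vdash t+u:A\odot B$; from $\Gamma\vdash t:A\odot B$, $\Gamma,x:A\vdash u:C$, $\Gamma,y:B\vdash v:C$ infer both $\Gamma\vdash\delta_\odot(t,[x]u,[y]v):C$ and $\Gamma\vdash\delta_\odot^\parallel(t,[x]u,[y]v):C$. Reduction rules: $(\lambda x\,t)\,u\to(u/x)t$; $\delta_\wedge(\langle t,u\rangle,[x,y]v)\to(t/x,u/y)v$; $\delta_\vee(\mathrm{inl}(t),[x]v,[y]w)\to(t/x)v$; $\delta_\vee(\mathrm{inr}(u),[x]v,[y]w)\to(u/y)w$; $\delta_\odot(t+u,[x]v,[y]w)\to(t/x)v$; $\delta_\odot(t+u,[x]v,[y]w)\to(u/y)w$; $\delta_\odot^\parallel(t+u,[x]v,[y]w)\to(t/x)v\parallel(u/y)w$;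 $(\lambda x\,t)\parallel(\lambda x\,u)\to\lambda x\,(t\parallel u)$; $\langle t,u\rangle\parallel\langle v,w\rangle\to\langle t\parallel v,u\parallel w\rangle$; $\delta_\vee(t\parallel u,[x]v,[y]w)\to\delta_\vee(t,[x]v,[y]w)\parallel\delta_\vee(u,[x]v,[y]w)$; $(t+u)\parallel(v+w)\to(t\parallel v)+(u\parallel w)$; $t\parallel t\to t$. The reduction relation $\longrightarrow$ is the smallest contextual relation containing $\sigma l\to\sigma r$ for every rule $l\to r$ and substitution $\sigma$; a term is irreducible if it has no one-step reduct. *)

theory Defs
  imports Main
begin

datatype prp =
    Top
  | Bot
  | Imp prp prp
  | Conj prp prp
  | Disj prp prp
  | Odot prp prp  (* A \<odot> B *)

text \<open>
  Proof-terms modulo renaming of bound variables are represented with de Bruijn indices: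
  index 0 is the variable bound by the innermost enclosing binder, and the indices that
  exceed the number of enclosing binders are the free variables. In \<open>ConjE t u\<close>, which is
  \<open>\<delta>\<^sub>\<and>(t, [x,y]u)\<close>, two variables are bound in \<open>u\<close>: \<open>y\<close> is index 0 and \<open>x\<close> is index 1.
\<close>

datatype trm =
    Var nat
  | Par trm trm           (* t \<parallel> u *)
  | Star
  | BotE trm              (* \<delta>\<^sub>\<bottom>(t) *)
  | Lam trm
  | App trm trm
  | Pair trm trm
  | ConjE trm trm         (* \<delta>\<^sub>\<and>(t, [x,y]u) *)
  | Inl trm
  | Inr trm
  | DisjE trm trm trm     (* \<delta>\<^sub>\<or>(t, [x]u, [y]v) *)
  | Plus trm trm          (* t + u *)
  | OdotE trm trm trm      (* \<delta>\<^sub>\<odot>(t, [x]u, [y]v) *)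
  | OdotParE trm trm trm   (* the parallel elimination of \<odot>, same arguments as OdotE *)

primrec fv :: "trm \<Rightarrow> nat set" where
  "fv (Var i) = {i}"
| "fv (Par t u) = fv t \<union> fv u"
| "fv Star = {}"
| "fv (BotE t) = fv t"
| "fv (Lam t) = {i. Suc i \<in> fv t}"
| "fv (App t u) = fv t \<union> fv u"
| "fv (Pair t u) = fv t \<union> fv u"
| "fv (ConjE t u) = fv t \<union> {i. Suc (Suc i) \<in> fv u}"
| "fv (Inl t) = fv t"
| "fv (Inr t) = fv t"
| "fv (DisjE t u v) = fv t \<union> {i. Suc i \<in> fv u} \<union> {i. Suc i \<in> fv v}"
| "fv (Plus t u) = fv t \<union> fv u"
| "fv (OdotE t u v) = fv t \<union> {i. Suc i \<in> fv u} \<union> {i. Suc i \<in> fv v}"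
| "fv (OdotParE t u v) = fv t \<union> {i. Suc i \<in> fv u} \<union> {i. Suc i \<in> fv v}"

definition closed_trm :: "trm \<Rightarrow> bool" where
  "closed_trm t \<longleftrightarrow> fv t = {}"

definition lift_ren :: "(nat \<Rightarrow> nat) \<Rightarrow> nat \<Rightarrow> nat" where
  "lift_ren \<rho> = case_nat 0 (\<lambda>i. Suc (\<rho> i))"

primrec rename :: "(nat \<Rightarrow> nat) \<Rightarrow> trm \<Rightarrow> trm" where
  "rename \<rho> (Var i) = Var (\<rho> i)"
| "rename \<rho> (Par t u) = Par (rename \<rho> t) (rename \<rho> u)"
| "rename \<rho> Star = Star"
| "rename \<rho> (BotE t) = BotE (rename \<rho> t)"
| "rename \<rho> (Lam t) = Lam (rename (lift_ren \<rho>) t)"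
| "rename \<rho> (App t u) = App (rename \<rho> t) (rename \<rho> u)"
| "rename \<rho> (Pair t u) = Pair (rename \<rho> t) (rename \<rho> u)"
| "rename \<rho> (ConjE t u) = ConjE (rename \<rho> t) (rename (lift_ren (lift_ren \<rho>)) u)"
| "rename \<rho> (Inl t) = Inl (rename \<rho> t)"
| "rename \<rho> (Inr t) = Inr (rename \<rho> t)"
| "rename \<rho> (DisjE t u v) =
    DisjE (rename \<rho> t) (rename (lift_ren \<rho>) u) (rename (lift_ren \<rho>) v)"
| "rename \<rho> (Plus t u) = Plus (rename \<rho> t) (rename \<rho> u)"
| "rename \<rho> (OdotE t u v) =
    OdotE (rename \<rho> t) (rename (lift_ren \<rho>) u) (rename (lift_ren \<rho>) v)"
| "rename \<rho> (OdotParE t u v) =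
    OdotParE (rename \<rho> t) (rename (lift_ren \<rho>) u) (rename (lift_ren \<rho>) v)"

definition lift_subst :: "(nat \<Rightarrow> trm) \<Rightarrow> nat \<Rightarrow> trm" where
  "lift_subst \<sigma> = case_nat (Var 0) (\<lambda>i. rename Suc (\<sigma> i))"

primrec subst :: "(nat \<Rightarrow> trm) \<Rightarrow> trm \<Rightarrow> trm" where
  "subst \<sigma> (Var i) = \<sigma> i"
| "subst \<sigma> (Par t u) = Par (subst \<sigma> t) (subst \<sigma> u)"
| "subst \<sigma> Star = Star"
| "subst \<sigma> (BotE t) = BotE (subst \<sigma> t)"
| "subst \<sigma> (Lam t) = Lam (subst (lift_subst \<sigma>) t)"
| "subst \<sigma> (App t u) = App (subst \<sigma> t) (subst \<sigma> u)"
| "subst \<sigma> (Pair t u) = Pair (subst \<sigma> t) (subst \<sigma> u)"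
| "subst \<sigma> (ConjE t u) = ConjE (subst \<sigma> t) (subst (lift_subst (lift_subst \<sigma>)) u)"
| "subst \<sigma> (Inl t) = Inl (subst \<sigma> t)"
| "subst \<sigma> (Inr t) = Inr (subst \<sigma> t)"
| "subst \<sigma> (DisjE t u v) =
    DisjE (subst \<sigma> t) (subst (lift_subst \<sigma>) u) (subst (lift_subst \<sigma>) v)"
| "subst \<sigma> (Plus t u) = Plus (subst \<sigma> t) (subst \<sigma> u)"
| "subst \<sigma> (OdotE t u v) =
    OdotE (subst \<sigma> t) (subst (lift_subst \<sigma>) u) (subst (lift_subst \<sigma>) v)"
| "subst \<sigma> (OdotParE t u v) =
    OdotParE (subst \<sigma> t) (subst (lift_subst \<sigma>) u) (subst (lift_subst \<sigma>) v)"

text \<open>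
  \<open>inst u t\<close> is \<open>(u/x)t\<close>, where \<open>x\<close> is index 0 of \<open>t\<close>. \<open>inst2 t u v\<close> is the simultaneous
  substitution \<open>(t/x, u/y)v\<close>, where \<open>x\<close> is index 1 and \<open>y\<close> is index 0 of \<open>v\<close>. The other
  indices decrease because the binders disappear.
\<close>

definition inst :: "trm \<Rightarrow> trm \<Rightarrow> trm" where
  "inst u t = subst (case_nat u Var) t"

definition inst2 :: "trm \<Rightarrow> trm \<Rightarrow> trm \<Rightarrow> trm" where
  "inst2 t u v = subst (case_nat u (case_nat t Var)) v"

text \<open>A context is the list of the propositions assigned to the indices 0, 1, 2, \<open>\<dots>\<close>.\<close>

inductive typing :: "prp list \<Rightarrow> trm \<Rightarrow> prp \<Rightarrow> bool" ("_ \<turnstile> _ \<^bold>: _" [50, 50, 50] 50) where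
  ax: "i < length \<Gamma> \<Longrightarrow> \<Gamma> ! i = A \<Longrightarrow> \<Gamma> \<turnstile> Var i \<^bold>: A"
| par: "\<Gamma> \<turnstile> t \<^bold>: A \<Longrightarrow> \<Gamma> \<turnstile> u \<^bold>: A \<Longrightarrow> \<Gamma> \<turnstile> Par t u \<^bold>: A"
| top_i: "\<Gamma> \<turnstile> Star \<^bold>: Top"
| bot_e: "\<Gamma> \<turnstile> t \<^bold>: Bot \<Longrightarrow> \<Gamma> \<turnstile> BotE t \<^bold>: C"
| imp_i: "A # \<Gamma> \<turnstile> t \<^bold>: B \<Longrightarrow> \<Gamma> \<turnstile> Lam t \<^bold>: Imp A B"
| imp_e: "\<Gamma> \<turnstile> t \<^bold>: Imp A B \<Longrightarrow> \<Gamma> \<turnstile> u \<^bold>: A \<Longrightarrow> \<Gamma> \<turnstile> App t u \<^bold>: B"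
| conj_i: "\<Gamma> \<turnstile> t \<^bold>: A \<Longrightarrow> \<Gamma> \<turnstile> u \<^bold>: B \<Longrightarrow> \<Gamma> \<turnstile> Pair t u \<^bold>: Conj A B"
| conj_e: "\<Gamma> \<turnstile> t \<^bold>: Conj A B \<Longrightarrow> B # A # \<Gamma> \<turnstile> u \<^bold>: C \<Longrightarrow> \<Gamma> \<turnstile> ConjE t u \<^bold>: C"
| disj_i1: "\<Gamma> \<turnstile> t \<^bold>: A \<Longrightarrow> \<Gamma> \<turnstile> Inl t \<^bold>: Disj A B"
| disj_i2: "\<Gamma> \<turnstile> t \<^bold>: B \<Longrightarrow> \<Gamma> \<turnstile> Inr t \<^bold>: Disj A B"
| disj_e: "\<Gamma> \<turnstile> t \<^bold>: Disj A B \<Longrightarrow> A # \<Gamma> \<turnstile> u \<^bold>: C \<Longrightarrow> B # \<Gamma> \<turnstile> v \<^bold>: C \<Longrightarrow> \<Gamma> \<turnstile> DisjE t u v \<^bold>: C"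
| odot_i: "\<Gamma> \<turnstile> t \<^bold>: A \<Longrightarrow> \<Gamma> \<turnstile> u \<^bold>: B \<Longrightarrow> \<Gamma> \<turnstile> Plus t u \<^bold>: Odot A B"
| odot_e: "\<Gamma> \<turnstile> t \<^bold>: Odot A B \<Longrightarrow> A # \<Gamma> \<turnstile> u \<^bold>: C \<Longrightarrow> B # \<Gamma> \<turnstile> v \<^bold>: C \<Longrightarrow> \<Gamma> \<turnstile> OdotE t u v \<^bold>: C"
| odot_par_e: "\<Gamma> \<turnstile> t \<^bold>: Odot A B \<Longrightarrow> A # \<Gamma> \<turnstile> u \<^bold>: C \<Longrightarrow> B # \<Gamma> \<turnstile> v \<^bold>: C \<Longrightarrow> \<Gamma> \<turnstile> OdotParE t u v \<^bold>: C"

text \<open>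
  \<open>red_rule l r\<close> holds if the pair \<open>(l, r)\<close> is an instance of a reduction rule. Since terms are
  identified up to renaming of bound variables, so are the two sides of \<open>Par t t\<close>.
\<close>

inductive red_rule :: "trm \<Rightarrow> trm \<Rightarrow> bool" where
  beta: "red_rule (App (Lam t) u) (inst u t)"
| conj: "red_rule (ConjE (Pair t u) v) (inst2 t u v)"
| disj_inl: "red_rule (DisjE (Inl t) v w) (inst t v)"
| disj_inr: "red_rule (DisjE (Inr u) v w) (inst u w)"
| odot_left: "red_rule (OdotE (Plus t u) v w) (inst t v)"
| odot_right: "red_rule (OdotE (Plus t u) v w) (inst u w)"
| odot_par: "red_rule (OdotParE (Plus t u) v w) (Par (inst t v) (inst u w))"
| par_lam: "red_rule (Par (Lam t) (Lam u)) (Lam (Par t u))"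
| par_pair: "red_rule (Par (Pair t u) (Pair v w)) (Pair (Par t v) (Par u w))"
| disj_par: "red_rule (DisjE (Par t u) v w) (Par (DisjE t v w) (DisjE u v w))"
| par_plus: "red_rule (Par (Plus t u) (Plus v w)) (Plus (Par t v) (Par u w))"
| par_idem: "red_rule (Par t t) t"

inductive red :: "trm \<Rightarrow> trm \<Rightarrow> bool" (infix "\<leadsto>" 50) where
  root: "red_rule l r \<Longrightarrow> l \<leadsto> r"
| red_Par1: "t \<leadsto> t' \<Longrightarrow> Par t u \<leadsto> Par t' u"
| red_Par2: "u \<leadsto> u' \<Longrightarrow> Par t u \<leadsto> Par t u'"
| red_BotE: "t \<leadsto> t' \<Longrightarrow> BotE t \<leadsto> BotE t'"
| red_Lam: "t \<leadsto> t' \<Longrightarrow> Lam t \<leadsto> Lam t'"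
| red_App1: "t \<leadsto> t' \<Longrightarrow> App t u \<leadsto> App t' u"
| red_App2: "u \<leadsto> u' \<Longrightarrow> App t u \<leadsto> App t u'"
| red_Pair1: "t \<leadsto> t' \<Longrightarrow> Pair t u \<leadsto> Pair t' u"
| red_Pair2: "u \<leadsto> u' \<Longrightarrow> Pair t u \<leadsto> Pair t u'"
| red_ConjE1: "t \<leadsto> t' \<Longrightarrow> ConjE t u \<leadsto> ConjE t' u"
| red_ConjE2: "u \<leadsto> u' \<Longrightarrow> ConjE t u \<leadsto> ConjE t u'"
| red_Inl: "t \<leadsto> t' \<Longrightarrow> Inl t \<leadsto> Inl t'"
| red_Inr: "t \<leadsto> t' \<Longrightarrow> Inr t \<leadsto> Inr t'"
| red_DisjE1: "t \<leadsto> t' \<Longrightarrow> DisjE t u v \<leadsto> DisjE t' u v"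
| red_DisjE2: "u \<leadsto> u' \<Longrightarrow> DisjE t u v \<leadsto> DisjE t u' v"
| red_DisjE3: "v \<leadsto> v' \<Longrightarrow> DisjE t u v \<leadsto> DisjE t u v'"
| red_Plus1: "t \<leadsto> t' \<Longrightarrow> Plus t u \<leadsto> Plus t' u"
| red_Plus2: "u \<leadsto> u' \<Longrightarrow> Plus t u \<leadsto> Plus t u'"
| red_OdotE1: "t \<leadsto> t' \<Longrightarrow> OdotE t u v \<leadsto> OdotE t' u v"
| red_OdotE2: "u \<leadsto> u' \<Longrightarrow> OdotE t u v \<leadsto> OdotE t u' v"
| red_OdotE3: "v \<leadsto> v' \<Longrightarrow> OdotE t u v \<leadsto> OdotE t u v'"
| red_OdotParE1: "t \<leadsto> t' \<Longrightarrow> OdotParE t u v \<leadsto> OdotParE t' u v"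
| red_OdotParE2: "u \<leadsto> u' \<Longrightarrow> OdotParE t u v \<leadsto> OdotParE t u' v"
| red_OdotParE3: "v \<leadsto> v' \<Longrightarrow> OdotParE t u v \<leadsto> OdotParE t u v'"

definition irreducible_trm :: "trm \<Rightarrow> bool" where
  "irreducible_trm t \<longleftrightarrow> (\<nexists>u. t \<leadsto> u)"

end

theory Submission
  imports Defs
begin

text \<open>In the empty context an irreducible term cannot end with an elimination: its principal
  argument is again irreducible and typed in the empty context, hence canonical, and so forms a
  redex with the eliminator. All connectives are treated in one induction
  (\<open>canonical_form\<close>), since eliminating one connective yields a term of arbitrary
  type.\<close>

fun canonical :: "prp \<Rightarrow> trm \<Rightarrow> bool" where
  "canonical Top t \<longleftrightarrow> t = Star"
| "canonical Bot t \<longleftrightarrow> False"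
| "canonical (Imp B C) t \<longleftrightarrow> (\<exists>u. t = Lam u)"
| "canonical (Conj B C) t \<longleftrightarrow> (\<exists>u v. t = Pair u v)"
| "canonical (Disj B C) t \<longleftrightarrow> (\<exists>u. t = Inl u) \<or> (\<exists>u. t = Inr u) \<or> (\<exists>u v. t = Par u v)"
| "canonical (Odot B C) t \<longleftrightarrow> (\<exists>u v. t = Plus u v)"

text \<open>The equation \<open>\<Gamma> = []\<close> is kept as a premise so that the induction
  ranges over all contexts; it rules out variables and makes the hypotheses for terms under binders
  vacuous.\<close>

lemma canonical_form:
  assumes "\<Gamma> \<turnstile> t \<^bold>: A" "\<Gamma> = []" "\<nexists>u. t \<leadsto> u"
  shows "canonical A t"
  using assms
proof (induction rule: typing.induct)
  case (par \<Gamma> t A u)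
  then have "canonical A t" "canonical A u"
    by (blast intro: red_Par1 red_Par2)+
  with par.prems show ?case
    by (cases A) (auto intro: root red_rule.intros)
next
  case (bot_e \<Gamma> t C)
  then have "canonical Bot t"
    by (blast intro: red_BotE)
  then show ?case by simp
next
  case (imp_e \<Gamma> t A B u)
  then have "canonical (Imp A B) t"
    by (blast intro: red_App1)
  with imp_e.prems show ?case
    by (auto intro: root red_rule.intros)
next
  case (conj_e \<Gamma> t A B u C)
  then have "canonical (Conj A B) t"
    by (blast intro: red_ConjE1)
  with conj_e.prems show ?case
    by (auto intro: root red_rule.intros)
next
  case (disj_e \<Gamma> t A B u C v)
  then have "canonical (Disj A B) t"
    by (blast intro: red_DisjE1)
  \<comment> \<open>Since \<open>Par\<close> is canonical at \<open>Disj\<close>, the rule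
    \<open>disj_par\<close> is what supplies a redex in that case.\<close>
  with disj_e.prems show ?case
    by (auto intro: root red_rule.intros)
next
  case (odot_e \<Gamma> t A B u C v)
  then have "canonical (Odot A B) t"
    by (blast intro: red_OdotE1)
  with odot_e.prems show ?case
    by (auto intro: root red_rule.intros)
next
  case (odot_par_e \<Gamma> t A B u C v)
  then have "canonical (Odot A B) t"
    by (blast intro: red_OdotParE1)
  with odot_par_e.prems show ?case
    by (auto intro: root red_rule.intros)
qed auto

theorem mainTheorem2:
  fixes t :: trm and A :: prp
  assumes "closed_trm t"
    and "irreducible_trm t"
    and "[] \<turnstile> t \<^bold>: A"
  shows "(A = Top \<longrightarrow> t = Star)
    \<and> A \<noteq> Bot
    \<and> (\<forall>B C. A = Imp B C \<longrightarrow> (\<exists>u. t = Lam u))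
    \<and> (\<forall>B C. A = Conj B C \<longrightarrow> (\<exists>u v. t = Pair u v))
    \<and> (\<forall>B C. A = Disj B C \<longrightarrow>
        (\<exists>u. t = Inl u) \<or> (\<exists>u. t = Inr u) \<or> (\<exists>u v. t = Par u v))
    \<and> (\<forall>B C. A = Odot B C \<longrightarrow> (\<exists>u v. t = Plus u v))"
proof -
  have "canonical A t"
    using canonical_form[OF assms(3) refl] assms(2) by (simp add: irreducible_trm_def)
  then show ?thesis by auto
qed

end
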